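(* Let $r,n$ be positive integers, $W=C_r\wr S_n$, and let $t$ be an integer with $0\le t\le n-1$. Suppose $Y\subseteq W$ is a $t$-design and an $(n-t)$-code. Then the distance distribution $(A_i)$ of $Y$ satisfies $$A_{n-i}=\sum_{j=i}^t(-1)^{j-i}\binom ji\binom nj\Big(\frac{|Y|}{r^j(n)_j}-1\Big)$$ for each $i\in\{0,1,\dots,n-1\}$.
   Context: $C_r=\mathbb{Z}/r\mathbb{Z}$; $[n]=\{1,\dots,n\}$. $W=C_r\wr S_n$ consists of pairs $(g,\pi)$, $g\in C_r^n$, $\pi\in S_n$, with $(f,\pi)(g,\sigma)=(f+g^\pi,\pi\sigma)$, $g^\pi=(g_{\pi^{-1}(1)},\dots,g_{\pi^{-1}(n)})$, acting on $C_r\times[n]$ by $(g,\pi)\cdot(c,i)=(c+g_{\pi(i)},\pi(i))$. $(n)_j=n(n-1)\cdots(n-j+1)$. A nonempty $Y\subseteq W$ is a $t$-design if there is $c>0$ such that for any two $t$-tuples $((c_1,i_1),\dots,(c_t,i_t))$, $((c'_1,i'_1),\dots,(c'_t,i'_t))$ of elements of $C_r\times[n]$ with $i_1,\dots,i_t$ pairwise distinct and $i'_1,\dots,i'_t$ pairwise distinct, exactly $c$ elements of $Y$ map the first tuple to the second (componentwise). For $1\le d\le n+1$, $Y$ is a $d$-code if for all distinct $x,y\in Y$ the element $x^{-1}y$ fixes $(0,i)$ for at most $n-d$ indices $i\in[n]$ (equivalently, $x^{-1}y$ fixes no tuple of $n-d+1$ elements $(c_k,i_k)$ with pairwise distinct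 $i_k$). For $g\in W$, $\theta(g)=\frac1r|\{(c,i):g(c,i)=(c,i)\}|$, and $d(x,y)=n-\theta(x^{-1}y)$. The distance distribution of $Y$ is $A_i=\frac1{|Y|}|\{(x,y)\in Y\times Y:d(x,y)=i\}|$, $0\le i\le n$. *)

theory Defs
  imports Complex_Main "HOL-Library.FuncSet" "HOL-Algebra.Elementary_Groups" "HOL-Algebra.Sym_Groups"
begin

(* C_r is integer_mod_group r, with underlying set {0..<r} for r > 0.  A vector in (C_r)^n is an
   extensional function on {1..n}, so that equality of elements of the wreath product is
   equality of pairs. *)

definition wreath :: "nat \<Rightarrow> nat \<Rightarrow> ((nat \<Rightarrow> int) \<times> (nat \<Rightarrow> nat)) monoid" where
  "wreath r n =
     \<lparr>carrier = ({1..n} \<rightarrow>\<^sub>E carrier (integer_mod_group r)) \<times> carrier (sym_group n),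
      monoid.mult = (\<lambda>(f, \<pi>) (g, \<sigma>).
        (\<lambda>i\<in>{1..n}. f i \<otimes>\<^bsub>integer_mod_group r\<^esub> g (inv' \<pi> i), \<pi> \<circ> \<sigma>)),
      one = (\<lambda>i\<in>{1..n}. 0, id)\<rparr>"

definition wreath_points :: "nat \<Rightarrow> nat \<Rightarrow> (int \<times> nat) set" where
  "wreath_points r n = carrier (integer_mod_group r) \<times> {1..n}"

definition wreath_act :: "nat \<Rightarrow> (nat \<Rightarrow> int) \<times> (nat \<Rightarrow> nat) \<Rightarrow> int \<times> nat \<Rightarrow> int \<times> nat" where
  "wreath_act r = (\<lambda>(g, \<pi>) (c, i). (c \<otimes>\<^bsub>integer_mod_group r\<^esub> g (\<pi> i), \<pi> i))"

definition wreath_tuples :: "nat \<Rightarrow> nat \<Rightarrow> nat \<Rightarrow> (int \<times> nat) list set" where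
  "wreath_tuples r n t =
     {a. length a = t \<and> set a \<subseteq> wreath_points r n \<and> distinct (map snd a)}"

definition is_design :: "nat \<Rightarrow> nat \<Rightarrow> nat \<Rightarrow> ((nat \<Rightarrow> int) \<times> (nat \<Rightarrow> nat)) set \<Rightarrow> bool" where
  "is_design r n t Y \<longleftrightarrow> Y \<noteq> {} \<and> Y \<subseteq> carrier (wreath r n) \<and>
     (\<exists>c>0. \<forall>a \<in> wreath_tuples r n t. \<forall>b \<in> wreath_tuples r n t.
        card {y \<in> Y. map (wreath_act r y) a = b} = c)"

(* "At most n - d" is stated additively because truncated subtraction on nat would be wrong for
   d = n + 1, where no two distinct elements are allowed. *)
definition is_code :: "nat \<Rightarrow> nat \<Rightarrow> nat \<Rightarrow> ((nat \<Rightarrow> int) \<times> (nat \<Rightarrow> nat)) set \<Rightarrow> bool" where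
  "is_code r n d Y \<longleftrightarrow> 1 \<le> d \<and> d \<le> n + 1 \<and> Y \<subseteq> carrier (wreath r n) \<and>
     (\<forall>x\<in>Y. \<forall>y\<in>Y. x \<noteq> y \<longrightarrow>
        card {i \<in> {1..n}.
          wreath_act r (inv\<^bsub>wreath r n\<^esub> x \<otimes>\<^bsub>wreath r n\<^esub> y) (0, i) = (0, i)} + d \<le> n)"

definition wreath_theta :: "nat \<Rightarrow> nat \<Rightarrow> (nat \<Rightarrow> int) \<times> (nat \<Rightarrow> nat) \<Rightarrow> real" where
  "wreath_theta r n g = 1 / real r * real (card {p \<in> wreath_points r n. wreath_act r g p = p})"

definition wreath_dist ::
  "nat \<Rightarrow> nat \<Rightarrow> (nat \<Rightarrow> int) \<times> (nat \<Rightarrow> nat) \<Rightarrow> (nat \<Rightarrow> int) \<times> (nat \<Rightarrow> nat) \<Rightarrow> real" where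
  "wreath_dist r n x y =
     real n - wreath_theta r n (inv\<^bsub>wreath r n\<^esub> x \<otimes>\<^bsub>wreath r n\<^esub> y)"

definition distance_distribution ::
  "nat \<Rightarrow> nat \<Rightarrow> ((nat \<Rightarrow> int) \<times> (nat \<Rightarrow> nat)) set \<Rightarrow> nat \<Rightarrow> real" where
  "distance_distribution r n Y i =
     1 / real (card Y) * real (card {(x, y) \<in> Y \<times> Y. wreath_dist r n x y = real i})"

definition falling :: "nat \<Rightarrow> nat \<Rightarrow> real" where
  "falling n j = (\<Prod>k<j. real n - real k)"

lemma group_wreath: "group (wreath r n)"
proof (rule groupI)
  fix x y assume "x \<in> carrier (wreath r n)" "y \<in> carrier (wreath r n)"
  then show "x \<otimes>\<^bsub>wreath r n\<^esub> y \<in> carrier (wreath r n)"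
    by (auto simp: wreath_def sym_group_carrier permutes_compose carrier_integer_mod_group)
next
  show "\<one>\<^bsub>wreath r n\<^esub> \<in> carrier (wreath r n)"
    by (auto simp: wreath_def sym_group_carrier permutes_id)
next
  fix x y z assume "x \<in> carrier (wreath r n)" "y \<in> carrier (wreath r n)" "z \<in> carrier (wreath r n)"
  then obtain f p g q h s where xyz: "x = (f, p)" "y = (g, q)" "z = (h, s)"
    and p: "p permutes {1..n}" and q: "q permutes {1..n}"
    by (auto simp: wreath_def sym_group_carrier)
  have 1: "inv' p i \<in> {1..n}" if "i \<in> {1..n}" for i
    using permutes_in_image[OF permutes_inv[OF p]] that by blast
  have 2: "inv' (p \<circ> q) = inv' q \<circ> inv' p"
    using p q by (simp add: o_inv_distrib permutes_bij)
  show "x \<otimes>\<^bsub>wreath r n\<^esub> y \<otimes>\<^bsub>wreath r n\<^esub> z = x \<otimes>\<^bsub>wreath r n\<^esub> (y \<otimes>\<^bsub>wreath r n\<^esub> z)"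
    unfolding xyz using 1 2
    by (auto simp: wreath_def fun_eq_iff restrict_def mod_add_left_eq mod_add_right_eq add.assoc)
next
  fix x assume "x \<in> carrier (wreath r n)"
  then show "\<one>\<^bsub>wreath r n\<^esub> \<otimes>\<^bsub>wreath r n\<^esub> x = x"
    by (cases "r = 0")
      (auto simp: wreath_def carrier_integer_mod_group fun_eq_iff PiE_def Pi_def extensional_def restrict_def)
next
  fix x assume "x \<in> carrier (wreath r n)"
  then obtain f p where x: "x = (f, p)" and f: "f \<in> {1..n} \<rightarrow>\<^sub>E carrier (integer_mod_group r)"
    and p: "p permutes {1..n}"
    by (auto simp: wreath_def sym_group_carrier)
  define y where "y = (\<lambda>i\<in>{1..n}. (- f (p i)) mod int r, inv' p)"
  have "y \<in> carrier (wreath r n)"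
    using p by (auto simp: y_def wreath_def sym_group_carrier permutes_inv carrier_integer_mod_group)
  moreover have "y \<otimes>\<^bsub>wreath r n\<^esub> x = \<one>\<^bsub>wreath r n\<^esub>"
    using p by (auto simp: y_def x wreath_def fun_eq_iff restrict_def mod_add_left_eq
        permutes_inv_inv permutes_inverses)
  ultimately show "\<exists>y\<in>carrier (wreath r n). y \<otimes>\<^bsub>wreath r n\<^esub> x = \<one>\<^bsub>wreath r n\<^esub>" by blast
qed

lemma wreath_act_mult:
  assumes "x \<in> carrier (wreath r n)" "y \<in> carrier (wreath r n)" "p \<in> wreath_points r n"
  shows "wreath_act r (x \<otimes>\<^bsub>wreath r n\<^esub> y) p = wreath_act r x (wreath_act r y p)"
proof -
  obtain f s g q c i where e: "x = (f, s)" "y = (g, q)" "p = (c, i)"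
    and s: "s permutes {1..n}" and q: "q permutes {1..n}" and i: "i \<in> {1..n}"
    using assms by (auto simp: wreath_def sym_group_carrier wreath_points_def)
  have "s (q i) \<in> {1..n}" using s q i by (meson permutes_in_image)
  then show ?thesis
    using s by (simp add: e wreath_act_def wreath_def permutes_inverses
        mod_add_left_eq mod_add_right_eq ac_simps)
qed

end

theory Submission
  imports Defs
begin

text \<open>For fixed \<open>x \<in> Y\<close>, count pairs \<open>(y, S)\<close> such that \<open>y \<in> Y\<close> acts like \<open>x\<close> on the points
  \<open>(0, k)\<close> for all \<open>k\<close> in the \<open>j\<close>-set \<open>S\<close>. Since a \<open>t\<close>-design is a \<open>j\<close>-design for
  \<open>j \<le> t\<close>, this gives the binomial moments
  \<open>\<Sum>y. \<theta>(x\<^sup>-\<^sup>1y) choose j = (n choose j) |Y| / (r\<^sup>j (n)\<^sub>j)\<close> for \<open>j \<le> t\<close>. The code property bounds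
  \<open>\<theta>(x\<^sup>-\<^sup>1y)\<close> by \<open>t\<close> for \<open>y \<noteq> x\<close>, so after removing the term \<open>y = x\<close> these moments
  determine the distribution of \<open>\<theta>(x\<^sup>-\<^sup>1y)\<close> by binomial inversion.\<close>

text \<open>Trinomial revision, \<open>(m choose j) (j choose i) = (m choose i) ((m - i) choose (j -
  i))\<close>, turns the sum into a multiple of the alternating sum of row \<open>m - i\<close> of
  Pascal's triangle, which vanishes unless \<open>m = i\<close>. The bound \<open>m \<le> t\<close>
  ensures that the cutoff at \<open>t\<close> loses only zero terms.\<close>

lemma binomial_inversion:
  fixes m i t :: nat
  assumes "m \<le> t"
  shows "(\<Sum>j = i..t. (- 1) ^ (j - i) * real (j choose i) * real (m choose j))
    = (if m = i then 1 else 0)"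
proof (cases "i \<le> m")
  case False
  then show ?thesis by (auto intro!: sum.neutral simp: binomial_eq_0)
next
  case True
  have "(\<Sum>j = i..t. (- 1) ^ (j - i) * real (j choose i) * real (m choose j))
    = (\<Sum>j = i..m. (- 1) ^ (j - i) * real (j choose i) * real (m choose j))"
    using assms by (intro sum.mono_neutral_right) (auto simp: binomial_eq_0)
  also have "\<dots> = (\<Sum>j = i..m. real (m choose i) * ((- 1) ^ (j - i) * real ((m - i) choose (j - i))))"
  proof (rule sum.cong[OF refl])
    fix j assume "j \<in> {i..m}"
    then have "real (m choose j) * real (j choose i) = real (m choose i) * real ((m - i) choose (j - i))"
      using choose_mult[of i j m] by (metis atLeastAtMost_iff of_nat_mult)
    then show "(- 1) ^ (j - i) * real (j choose i) * real (m choose j)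
      = real (m choose i) * ((- 1) ^ (j - i) * real ((m - i) choose (j - i)))"
      by (simp add: ac_simps)
  qed
  also have "\<dots> = real (m choose i) * (\<Sum>k\<le>m - i. (- 1) ^ k * real ((m - i) choose k))"
    unfolding sum_distrib_left
    by (rule sum.reindex_bij_witness[of _ "\<lambda>k. k + i" "\<lambda>j. j - i"]) (use True in auto)
  also have "\<dots> = (if m = i then 1 else 0)"
    using choose_alternating_sum[of "m - i", where 'a = real] True by (cases "m = i") simp_all
  finally show ?thesis .
qed

lemma falling_pos: "j \<le> n \<Longrightarrow> 0 < falling n j"
  unfolding falling_def by (rule prod_pos) auto

section \<open>The action on points and tuples, and agreement sets\<close>

lemma wreath_act_in_points:
  assumes "0 < r" "x \<in> carrier (wreath r n)" "p \<in> wreath_points r n"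
  shows "wreath_act r x p \<in> wreath_points r n"
proof -
  obtain g s c i where e: "x = (g, s)" "p = (c, i)" by (metis surj_pair)
  then have s: "s permutes {1..n}" and i: "i \<in> {1..n}"
    using assms(2,3) by (simp_all add: wreath_def sym_group_carrier wreath_points_def)
  have "s i \<in> {1..n}" using s i by (meson permutes_in_image)
  then show ?thesis
    using assms(1) by (simp add: e wreath_points_def wreath_act_def carrier_integer_mod_group)
qed

lemma wreath_act_one:
  assumes "0 < r" "p \<in> wreath_points r n"
  shows "wreath_act r \<one>\<^bsub>wreath r n\<^esub> p = p"
  using assms
  by (auto simp: wreath_def wreath_points_def wreath_act_def carrier_integer_mod_group)

lemma wreath_act_tuple:
  assumes "0 < r" "x \<in> carrier (wreath r n)" "a \<in> wreath_tuples r n j"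
  shows "map (wreath_act r x) a \<in> wreath_tuples r n j"
proof -
  obtain g s where x: "x = (g, s)" by fastforce
  then have s: "s permutes {1..n}"
    using assms(2) by (simp add: wreath_def sym_group_carrier)
  have "map snd (map (wreath_act r x) a) = map s (map snd a)"
    by (auto simp: x wreath_act_def)
  moreover have "distinct (map s (map snd a))"
    unfolding distinct_map[of s] using assms(3) permutes_inj_on[OF s]
    by (simp add: wreath_tuples_def)
  ultimately have "distinct (map snd (map (wreath_act r x) a))" by (simp only:)
  then show ?thesis
    using assms wreath_act_in_points[OF assms(1,2)] by (auto simp: wreath_tuples_def)
qed

text \<open>An inverse-free form of the set of indices \<open>k\<close> for which
  \<open>x^{-1} y\<close> fixes \<open>(0, k)\<close>; for group elements and \<open>r > 0\<close>
  its size is the theta value of \<open>x^{-1} y\<close>.\<close>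

definition agree :: "nat \<Rightarrow> nat \<Rightarrow> (nat \<Rightarrow> int) \<times> (nat \<Rightarrow> nat) \<Rightarrow> (nat \<Rightarrow> int) \<times> (nat \<Rightarrow> nat) \<Rightarrow> nat set"
  where "agree r n x y = {k \<in> {1..n}. wreath_act r x (0, k) = wreath_act r y (0, k)}"

lemma finite_agree [simp]: "finite (agree r n x y)"
  by (simp add: agree_def)

lemma card_agree_self [simp]: "card (agree r n x x) = n"
proof -
  have "agree r n x x = {1..n}" by (auto simp: agree_def)
  then show ?thesis by simp
qed

text \<open>The action commutes with translation of the first coordinate, so of the \<open>r\<close>
  points over an index either all are fixed or none is. The factor \<open>1 / r\<close> in theta
  cancels this fibre size.\<close>

lemma wreath_theta_eq:
  assumes "0 < r" "z \<in> carrier (wreath r n)"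
  shows "wreath_theta r n z = real (card {i \<in> {1..n}. wreath_act r z (0, i) = (0, i)})"
proof -
  obtain g s where z: "z = (g, s)" by fastforce
  \<comment> \<open>Whether a point is fixed does not depend on \<open>c\<close>; the range of
    \<open>c\<close> makes it its own residue.\<close>
  have add_fixed: "(c + u) mod int r = c \<longleftrightarrow> u mod int r = 0"
    if "0 \<le> c" "c < int r" for c u
    using mod_eq_dvd_iff[of "c + u" "int r" c] mod_pos_pos_trivial[OF that]
    by (simp only: add_diff_cancel_left' mod_eq_0_iff_dvd)
  have "{p \<in> wreath_points r n. wreath_act r z p = p}
    = {0..<int r} \<times> {i \<in> {1..n}. wreath_act r z (0, i) = (0, i)}"
    using assms(1)
    by (auto simp: wreath_points_def wreath_act_def z carrier_integer_mod_group add_fixed)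
  then show ?thesis
    using assms(1) by (simp add: wreath_theta_def card_cartesian_product)
qed

section \<open>Passing from a design to shorter tuples\<close>

lemma finite_wreath:
  assumes "0 < r"
  shows "finite (carrier (wreath r n))"
  using assms
  by (auto simp: wreath_def sym_group_def carrier_integer_mod_group finite_permutations
      intro!: finite_PiE)

text \<open>The counting condition of a design with its constant exposed, so that the constant can
  be tracked as the tuple length drops.\<close>

definition uniform :: "nat \<Rightarrow> nat \<Rightarrow> nat \<Rightarrow> ((nat \<Rightarrow> int) \<times> (nat \<Rightarrow> nat)) set \<Rightarrow> nat \<Rightarrow> bool" where
  "uniform r n j Y c \<longleftrightarrow> (\<forall>a \<in> wreath_tuples r n j. \<forall>b \<in> wreath_tuples r n j.
     card {y \<in> Y. map (wreath_act r y) a = b} = c)"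

lemma wreath_tuples_snoc:
  "a @ [p] \<in> wreath_tuples r n (Suc j) \<longleftrightarrow>
    a \<in> wreath_tuples r n j \<and> p \<in> carrier (integer_mod_group r) \<times> ({1..n} - snd ` set a)"
  by (cases p) (auto simp: wreath_tuples_def wreath_points_def)

lemma card_free_points:
  assumes "0 < r" "a \<in> wreath_tuples r n j"
  shows "card (carrier (integer_mod_group r) \<times> ({1..n} - snd ` set a)) = r * (n - j)"
proof -
  have "card (snd ` set a) = j"
    using assms(2) distinct_card[of "map snd a"] by (simp add: wreath_tuples_def)
  moreover have "snd ` set a \<subseteq> {1..n}"
    using assms(2) by (auto simp: wreath_tuples_def wreath_points_def)
  ultimately have "card ({1..n} - snd ` set a) = n - j"
    by (simp add: card_Diff_subset)
  then show ?thesis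
    using assms(1) by (simp add: card_cartesian_product carrier_integer_mod_group)
qed

text \<open>Fix one point \<open>p\<close> that extends \<open>a\<close>. The elements taking
  \<open>a\<close> to \<open>b\<close> are sorted by the image \<open>q\<close> of \<open>p\<close>:
  there are \<open>r * (n - j)\<close> possible images, each attained by exactly \<open>c\<close>
  elements.\<close>

lemma uniform_step:
  assumes "0 < r" "j < n" "Y \<subseteq> carrier (wreath r n)" "uniform r n (Suc j) Y c"
  shows "uniform r n j Y (c * (r * (n - j)))"
  unfolding uniform_def
proof (intro ballI)
  fix a b assume a: "a \<in> wreath_tuples r n j" and b: "b \<in> wreath_tuples r n j"
  let ?F = "\<lambda>a. carrier (integer_mod_group r) \<times> ({1..n} - snd ` set a)"
  have "card (?F a) > 0" using card_free_points[OF assms(1) a] assms by simp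
  then obtain p where "p \<in> ?F a" by (metis all_not_in_conv card_gt_0_iff)
  then have ap: "a @ [p] \<in> wreath_tuples r n (Suc j)" using a wreath_tuples_snoc by blast
  have fin: "finite Y" using finite_subset[OF assms(3) finite_wreath[OF assms(1)]] .
  have finF: "finite (?F b)" using assms(1) by (simp add: carrier_integer_mod_group)
  \<comment> \<open>The extended tuple is sent to an admissible tuple, so the index of the image of
    \<open>p\<close> does not occur in \<open>b\<close>.\<close>
  have "wreath_act r y p \<in> ?F b" if y: "y \<in> Y" "map (wreath_act r y) a = b" for y
    using wreath_act_tuple[OF assms(1) subsetD[OF assms(3) y(1)] ap] y(2)
      wreath_tuples_snoc[of b "wreath_act r y p"] by simp
  then have "card {y \<in> Y. map (wreath_act r y) a = b} = (\<Sum>q \<in> ?F b.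
      card {y \<in> {y \<in> Y. map (wreath_act r y) a = b}. wreath_act r y p = q})"
    unfolding card_eq_sum by (intro sum.group[symmetric] finF image_subsetI) (use fin in simp_all)
  also have "\<dots> = (\<Sum>q \<in> ?F b. c)"
  proof (rule sum.cong[OF refl])
    fix q assume "q \<in> ?F b"
    then have "b @ [q] \<in> wreath_tuples r n (Suc j)" using b wreath_tuples_snoc by blast
    then have "card {y \<in> Y. map (wreath_act r y) (a @ [p]) = b @ [q]} = c"
      using assms(4) ap unfolding uniform_def by blast
    then show "card {y \<in> {y \<in> Y. map (wreath_act r y) a = b}. wreath_act r y p = q} = c"
      by (simp add: conj_assoc)
  qed
  also have "\<dots> = c * (r * (n - j))"
    using card_free_points[OF assms(1) b] by simp
  finally show "card {y \<in> Y. map (wreath_act r y) a = b} = c * (r * (n - j))" .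
qed

text \<open>Induction downwards from \<open>t\<close> to \<open>j\<close>, each shortening by one
  point contributing its factor.\<close>

lemma uniform_le:
  assumes "0 < r" "Y \<subseteq> carrier (wreath r n)" "j \<le> t" "t \<le> n" "uniform r n t Y c"
  shows "uniform r n j Y (c * (\<Prod>k = j..<t. r * (n - k)))"
  using assms(3)
proof (induction rule: inc_induct)
  case base
  then show ?case using assms by simp
next
  case (step m)
  then have "uniform r n m Y (c * (\<Prod>k = Suc m..<t. r * (n - k)) * (r * (n - m)))"
    by (intro uniform_step[OF assms(1) _ assms(2)]) (use assms(4) in simp_all)
  then show ?case
    using step.hyps by (simp add: prod.atLeast_Suc_lessThan ac_simps)
qed

text \<open>Shortening all the way to the empty tuple determines the constant, since every element
  of \<open>Y\<close> maps the empty tuple to itself.\<close>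

lemma uniform_card:
  assumes "0 < r" "Y \<subseteq> carrier (wreath r n)" "j \<le> n" "uniform r n j Y c"
  shows "real c * (real r ^ j * falling n j) = real (card Y)"
proof -
  have "[] \<in> wreath_tuples r n 0" by (simp add: wreath_tuples_def)
  then have "card {y \<in> Y. map (wreath_act r y) [] = []} = c * (\<Prod>k = 0..<j. r * (n - k))"
    using uniform_le[OF assms(1,2) _ assms(3,4), of 0] unfolding uniform_def by blast
  then have "real (card Y) = real c * (\<Prod>k<j. real r * real (n - k))"
    by (simp add: lessThan_atLeast0 del: of_nat_diff)
  also have "(\<Prod>k<j. real r * real (n - k)) = real r ^ j * falling n j"
    using assms(3) by (simp add: prod.distrib falling_def of_nat_diff)
  finally show ?thesis by simp
qed

section \<open>Binomial moments of the agreement sizes and the distance distribution\<close>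

theorem theorem6p6:
  fixes r n t :: nat and Y :: "((nat \<Rightarrow> int) \<times> (nat \<Rightarrow> nat)) set"
  assumes "0 < r" and "0 < n" and "t \<le> n - 1"
    and "Y \<subseteq> carrier (wreath r n)"
    and "is_design r n t Y"
    and "is_code r n (n - t) Y"
  shows "\<forall>i \<in> {0..n - 1}.
    distance_distribution r n Y (n - i) =
      (\<Sum>j = i..t. (- 1) ^ (j - i) * real (j choose i) * real (n choose j) *
         (real (card Y) / (real r ^ j * falling n j) - 1))"
proof
  fix i assume i: "i \<in> {0..n - 1}"
  have tn: "t \<le> n" using assms(3) by simp
  have fin: "finite Y" using finite_subset[OF assms(4) finite_wreath[OF assms(1)]] .
  have Y0: "card Y > 0" using assms(5) fin by (auto simp: is_design_def card_gt_0_iff)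
  obtain c where c: "uniform r n t Y c"
    using assms(5) unfolding is_design_def uniform_def by blast
  have inv_mult: "inv\<^bsub>wreath r n\<^esub> x \<otimes>\<^bsub>wreath r n\<^esub> y \<in> carrier (wreath r n)"
    if "x \<in> Y" "y \<in> Y" for x y
    using subsetD[OF assms(4) that(1)] subsetD[OF assms(4) that(2)]
    by (intro monoid.m_closed group.is_monoid group_wreath group.inv_closed)
  have fixed_eq_agree:
    "{i \<in> {1..n}. wreath_act r (inv\<^bsub>wreath r n\<^esub> x \<otimes>\<^bsub>wreath r n\<^esub> y) (0, i) = (0, i)} = agree r n x y"
    if "x \<in> Y" "y \<in> Y" for x y
  proof -
    have x: "x \<in> carrier (wreath r n)" and y: "y \<in> carrier (wreath r n)"
      using that assms(4) by auto
    have ix: "inv\<^bsub>wreath r n\<^esub> x \<in> carrier (wreath r n)"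
      using group.inv_closed[OF group_wreath x] .
    \<comment> \<open>Apply \<open>x\<close> to both sides for one direction and the inverse of
      \<open>x\<close> for the other.\<close>
    have "wreath_act r (inv\<^bsub>wreath r n\<^esub> x \<otimes>\<^bsub>wreath r n\<^esub> y) (0, i) = (0, i)
        \<longleftrightarrow> wreath_act r x (0, i) = wreath_act r y (0, i)" if "i \<in> {1..n}" for i
    proof -
      have p: "(0, i) \<in> wreath_points r n"
        using that assms(1) by (auto simp: wreath_points_def carrier_integer_mod_group)
      have q: "wreath_act r y (0, i) \<in> wreath_points r n"
        using wreath_act_in_points[OF assms(1) y p] .
      have 1: "wreath_act r (inv\<^bsub>wreath r n\<^esub> x \<otimes>\<^bsub>wreath r n\<^esub> y) (0, i)
        = wreath_act r (inv\<^bsub>wreath r n\<^esub> x) (wreath_act r y (0, i))"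
        using wreath_act_mult[OF ix y p] .
      have 2: "wreath_act r x (wreath_act r (inv\<^bsub>wreath r n\<^esub> x) (wreath_act r y (0, i)))
        = wreath_act r y (0, i)"
        using wreath_act_mult[OF x ix q] wreath_act_one[OF assms(1) q]
          group.r_inv[OF group_wreath x] by simp
      have 3: "wreath_act r (inv\<^bsub>wreath r n\<^esub> x) (wreath_act r x (0, i)) = (0, i)"
        using wreath_act_mult[OF ix x p] wreath_act_one[OF assms(1) p]
          group.l_inv[OF group_wreath x] by simp
      show ?thesis using 1 2 3 by metis
    qed
    then show ?thesis by (auto simp: agree_def)
  qed
  \<comment> \<open>The code bound \<open>n - (n - t)\<close> equals \<open>t\<close> because
    \<open>t \<le> n\<close>.\<close>
  have le_t: "card (agree r n x y) \<le> t" if "x \<in> Y" "y \<in> Y" "x \<noteq> y" for x y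
  proof -
    have "card (agree r n x y) + (n - t) \<le> n"
      unfolding fixed_eq_agree[OF that(1,2), symmetric]
      using assms(6) that unfolding is_code_def by blast
    then show ?thesis using tn by simp
  qed
  \<comment> \<open>The \<open>j\<close>-th binomial moment of the agreement sizes with a fixed
    \<open>x\<close>, taken over \<open>y \<noteq> x\<close>. The \<open>-1\<close> removes the
    contribution \<open>n choose j\<close> of \<open>y = x\<close>. The value does not depend on
    \<open>x\<close>.\<close>
  define D where "D j = real (n choose j) * (real (card Y) / (real r ^ j * falling n j) - 1)" for j
  have dist: "wreath_dist r n x y = real n - real (card (agree r n x y))"
    if "x \<in> Y" "y \<in> Y" for x y
    unfolding wreath_dist_def wreath_theta_eq[OF assms(1) inv_mult[OF that]]
      fixed_eq_agree[OF that] ..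
  have moment: "(\<Sum>y\<in>Y - {x}. real (card (agree r n x y) choose j)) = D j"
    if x: "x \<in> Y" and j: "j \<le> t" for x j
  proof -
    have xW: "x \<in> carrier (wreath r n)" using x assms(4) by blast
    have jn: "j \<le> n" using j tn by simp
    obtain c' where c': "uniform r n j Y c'" using uniform_le[OF assms(1,4) j tn c] by blast
    let ?P = "{S. S \<subseteq> {1..n} \<and> card S = j}"
    have finP: "finite ?P" by simp
    have extend: "card {y \<in> Y. S \<subseteq> agree r n x y} = c'" if S: "S \<in> ?P" for S
    proof -
      have fS: "finite S" using S finite_subset by blast
      \<comment> \<open>Agreement on \<open>S\<close> means that \<open>y\<close> sends this tuple
        to its image under \<open>x\<close>, which is again admissible, so the design count
        applies.\<close>
      define a where "a = map (\<lambda>k. (0::int, k)) (sorted_list_of_set S)"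
      have "map snd a = sorted_list_of_set S" by (simp add: a_def o_def)
      then have a: "a \<in> wreath_tuples r n j"
        using S fS assms(1) by (auto simp: wreath_tuples_def wreath_points_def a_def
            carrier_integer_mod_group)
      have "S \<subseteq> agree r n x y \<longleftrightarrow> map (wreath_act r y) a = map (wreath_act r x) a" for y
        using S fS by (auto simp: a_def agree_def)
      then have "{y \<in> Y. S \<subseteq> agree r n x y}
        = {y \<in> Y. map (wreath_act r y) a = map (wreath_act r x) a}" by blast
      then show ?thesis
        using c' a wreath_act_tuple[OF assms(1) xW a] by (simp only: uniform_def)
    qed
    have "(\<Sum>y\<in>Y. card (agree r n x y) choose j) = (\<Sum>y\<in>Y. card {S \<in> ?P. S \<subseteq> agree r n x y})"
    proof (rule sum.cong[OF refl])
      fix y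
      have "{S \<in> ?P. S \<subseteq> agree r n x y} = {S. S \<subseteq> agree r n x y \<and> card S = j}"
        by (auto simp: agree_def)
      then show "card (agree r n x y) choose j = card {S \<in> ?P. S \<subseteq> agree r n x y}"
        by (simp add: n_subsets)
    qed
    \<comment> \<open>Double counting of the pairs \<open>(y, S)\<close>.\<close>
    also have "\<dots> = (\<Sum>S\<in>?P. card {y \<in> Y. S \<subseteq> agree r n x y})"
      using sum.swap_restrict[OF fin finP, of "\<lambda>_ _. 1::nat" "\<lambda>y S. S \<subseteq> agree r n x y"] by simp
    also have "\<dots> = (\<Sum>S\<in>?P. c')"
      using extend by (intro sum.cong) auto
    also have "\<dots> = (n choose j) * c'" by (simp add: n_subsets)
    finally have "(\<Sum>y\<in>Y. real (card (agree r n x y) choose j)) = real (n choose j) * real c'"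
      by (metis (mono_tags, lifting) of_nat_mult of_nat_sum sum.cong)
    moreover have "real c' = real (card Y) / (real r ^ j * falling n j)"
      using uniform_card[OF assms(1,4) jn c'] falling_pos[OF jn] assms(1)
      by (simp add: field_simps)
    ultimately show ?thesis
      using fin x by (simp add: sum_diff1 D_def algebra_simps)
  qed
  have row: "real (card {y \<in> Y. wreath_dist r n x y = real (n - i)})
    = (\<Sum>j = i..t. (- 1) ^ (j - i) * real (j choose i) * D j)" if x: "x \<in> Y" for x
  proof -
    \<comment> \<open>Distance \<open>n - i\<close> means agreement in exactly \<open>i\<close>
      places. As \<open>i < n\<close>, the element \<open>x\<close> itself, which agrees in
      \<open>n\<close> places, is not counted; this leaves only elements to which the bound
      \<open>t\<close> applies.\<close>
    have "{y \<in> Y. wreath_dist r n x y = real (n - i)} = {y \<in> Y - {x}. card (agree r n x y) = i}"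
    proof -
      have "wreath_dist r n x y = real (n - i) \<longleftrightarrow> card (agree r n x y) = i" if "y \<in> Y" for y
        using dist[OF x that] i by (auto simp: of_nat_diff)
      then show ?thesis using i assms(2) by auto
    qed
    then have "real (card {y \<in> Y. wreath_dist r n x y = real (n - i)})
      = (\<Sum>y\<in>Y - {x}. if card (agree r n x y) = i then 1 else 0)"
      using fin by (simp add: sum.If_cases Int_def conj_commute)
    \<comment> \<open>Binomial inversion expands the indicator of agreement size \<open>i\<close>;
      exchanging the sums then brings in the moments.\<close>
    also have "\<dots> = (\<Sum>y\<in>Y - {x}. \<Sum>j = i..t.
        (- 1) ^ (j - i) * real (j choose i) * real (card (agree r n x y) choose j))"
      using le_t[OF x] by (intro sum.cong[OF refl] binomial_inversion[symmetric]) auto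
    also have "\<dots> = (\<Sum>j = i..t. (- 1) ^ (j - i) * real (j choose i)
        * (\<Sum>y\<in>Y - {x}. real (card (agree r n x y) choose j)))"
      by (subst sum.swap) (simp add: sum_distrib_left)
    also have "\<dots> = (\<Sum>j = i..t. (- 1) ^ (j - i) * real (j choose i) * D j)"
      using moment[OF x] by (intro sum.cong) auto
    finally show ?thesis .
  qed
  have "{(x, y) \<in> Y \<times> Y. wreath_dist r n x y = real (n - i)}
    = (SIGMA x:Y. {y \<in> Y. wreath_dist r n x y = real (n - i)})" by auto
  then have "real (card {(x, y) \<in> Y \<times> Y. wreath_dist r n x y = real (n - i)})
    = (\<Sum>x\<in>Y. real (card {y \<in> Y. wreath_dist r n x y = real (n - i)}))"
    using fin by simp
  \<comment> \<open>Each row count is the same for all \<open>x\<close>, so averaging over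
    \<open>Y\<close> returns that common value.\<close>
  also have "\<dots> = real (card Y) * (\<Sum>j = i..t. (- 1) ^ (j - i) * real (j choose i) * D j)"
    using row by simp
  finally show "distance_distribution r n Y (n - i) =
      (\<Sum>j = i..t. (- 1) ^ (j - i) * real (j choose i) * real (n choose j) *
         (real (card Y) / (real r ^ j * falling n j) - 1))"
    using Y0 by (simp add: distance_distribution_def D_def mult.assoc)
qed

end
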